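(* Let $G=(V,E)$ be an undirected graph, and let $(V,\mathcal{F}_E)$ be the associated semi-uniform space, i.e. $\mathcal{F}_E$ is the filter on $V\times V$ generated by the single set $E\subset V\times V$, where $E$ is regarded as a symmetric relation containing the diagonal of $V\times V$. Then $H_*^{VR}(V,\mathcal{F}_E)$ and $H^*_{VR}(V,\mathcal{F}_E)$ are isomorphic to the homology and cohomology, respectively, of the clique complex of $G$.
   Context: The filter generated by a set $E\subset V\times V$ is the collection of all subsets of $V\times V$ containing $E$. The clique complex of $G$ is the simplicial complex with vertex set $V$ whose simplices are the finite nonempty sets of pairwise adjacent vertices. For a relation $U\subset X\times X$, the Vietoris-Rips complex $\Sigma^X_U$ is the simplicial complex with vertex set $X$ in which a finite nonempty set is a simplex iff its elements can be ordered as $x_0,\dots,x_q$ (distinct) so that $(x_i,x_j)\in U$ for all $i<j$. For a semi-uniform structure $\mathcal{F}$ on $X$ (a filter on $X\times X$ each of whose elements contains the diagonal and such that $U\in\mathcal{F}$ implies $U^{-1}=\{(y,x)\mid (x,y)\in U\}\in\mathcal{F}$; for example $\mathcal{F}=\mathcal{F}_E$ with $X=V$), with integer coefficients, $H_*^{VR}(X,\mathcal{F})=\varprojlim_{U\in\mathcal{F}}H_*(\Sigma^X_U)$ and $H^*_{VR}(X,\mathcal{F})=\varinjlim_{U\in\mathcal{F}}H^*(\Sigma^X_U)$, with structure maps induced by the inclusions $\Sigma^X_U\subset\Sigma^X_{U'}$ for $U\subset U'$ in $\mathcal{F}$. *)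

theory Defs
  imports "HOL-Algebra.Free_Abelian_Groups" "HOL-Combinatorics.Permutations"
begin

section \<open>Graphs and semi-uniform structures\<close>

text \<open>The edge set of an undirected graph is regarded as a symmetric relation on the vertex set
  that contains the diagonal. The diagonal pairs carry no information.\<close>

definition undirected_graph :: "'a set \<Rightarrow> 'a rel \<Rightarrow> bool"
  where "undirected_graph V E \<longleftrightarrow> E \<subseteq> V \<times> V \<and> sym E \<and> refl_on V E"

definition filter_on :: "'b set \<Rightarrow> 'b set set \<Rightarrow> bool"
  where "filter_on S F \<longleftrightarrow> F \<subseteq> Pow S \<and> S \<in> F \<and> (\<forall>A\<in>F. \<forall>B\<in>F. A \<inter> B \<in> F) \<and>
    (\<forall>A\<in>F. \<forall>B. A \<subseteq> B \<and> B \<subseteq> S \<longrightarrow> B \<in> F)"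

definition semi_uniform_structure :: "'a set \<Rightarrow> 'a rel set \<Rightarrow> bool"
  where "semi_uniform_structure X F \<longleftrightarrow>
    filter_on (X \<times> X) F \<and> (\<forall>U\<in>F. Id_on X \<subseteq> U) \<and> (\<forall>U\<in>F. converse U \<in> F)"

definition generated_filter :: "'b set \<Rightarrow> 'b set \<Rightarrow> 'b set set"
  where "generated_filter S E = {U. E \<subseteq> U \<and> U \<subseteq> S}"

lemma semi_uniform_structure_generated_filter:
  assumes "undirected_graph V E"
  shows "semi_uniform_structure V (generated_filter (V \<times> V) E)"
proof -
  have "converse E = E"
    using assms by (auto simp: undirected_graph_def dest: symD)
  then show ?thesis
    using assms
    by (auto simp: undirected_graph_def semi_uniform_structure_def filter_on_def
        generated_filter_def refl_on_def)
qed


section \<open>Simplicial complexes\<close>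

text \<open>A simplicial complex is represented by its set of simplices; its vertices are the elements
  of its simplices.\<close>

definition simplicial_complex :: "'a set set \<Rightarrow> bool"
  where "simplicial_complex K \<longleftrightarrow>
    (\<forall>s\<in>K. finite s \<and> s \<noteq> {}) \<and> (\<forall>s\<in>K. \<forall>t. t \<subseteq> s \<and> t \<noteq> {} \<longrightarrow> t \<in> K)"

definition clique_complex :: "'a set \<Rightarrow> 'a rel \<Rightarrow> 'a set set"
  where "clique_complex V E = {s. finite s \<and> s \<noteq> {} \<and> s \<subseteq> V \<and>
    (\<forall>x\<in>s. \<forall>y\<in>s. x \<noteq> y \<longrightarrow> (x, y) \<in> E)}"

definition vietoris_rips_complex :: "'a set \<Rightarrow> 'a rel \<Rightarrow> 'a set set"
  where "vietoris_rips_complex X U = {s. s \<subseteq> X \<and>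
    (\<exists>xs. xs \<noteq> [] \<and> distinct xs \<and> set xs = s \<and>
      (\<forall>i j. i < j \<and> j < length xs \<longrightarrow> (xs ! i, xs ! j) \<in> U))}"

lemma simplicial_complex_clique_complex: "simplicial_complex (clique_complex V E)"
  by (auto simp: simplicial_complex_def clique_complex_def intro: finite_subset)

lemma vietoris_rips_complex_sorted_wrt:
  "vietoris_rips_complex X U =
    {s. s \<subseteq> X \<and> (\<exists>xs. xs \<noteq> [] \<and> distinct xs \<and> set xs = s \<and> sorted_wrt (\<lambda>x y. (x, y) \<in> U) xs)}"
  by (simp add: vietoris_rips_complex_def sorted_wrt_iff_nth_less imp_conjL)

lemma simplicial_complex_vietoris_rips_complex:
  "simplicial_complex (vietoris_rips_complex X U)"
  unfolding simplicial_complex_def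
proof (intro conjI ballI allI impI)
  fix s assume "s \<in> vietoris_rips_complex X U"
  then show "finite s" "s \<noteq> {}"
    by (auto simp: vietoris_rips_complex_def)
next
  fix s t assume "s \<in> vietoris_rips_complex X U" and t: "t \<subseteq> s \<and> t \<noteq> {}"
  then obtain xs where "s \<subseteq> X" "distinct xs" "set xs = s" "sorted_wrt (\<lambda>x y. (x, y) \<in> U) xs"
    by (auto simp: vietoris_rips_complex_sorted_wrt)
  with t show "t \<in> vietoris_rips_complex X U"
    unfolding vietoris_rips_complex_sorted_wrt
    by (auto intro!: exI[of _ "filter (\<lambda>x. x \<in> t) xs"] sorted_wrt_filter simp: filter_empty_conv)
qed


section \<open>Oriented simplicial chains\<close>

type_synonym 'b frag = "'b \<Rightarrow>\<^sub>0 int"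

text \<open>The map between quotient groups that sends the coset of \<open>x\<close> to the \<open>N\<close>-coset of \<open>f x\<close>,
  where \<open>N\<close> is a normal subgroup of \<open>H\<close>. It is meaningful only if \<open>f\<close> sends the subgroup that is
  factored out in the domain into \<open>N\<close>.\<close>

definition coset_map :: "('c, 'd) monoid_scheme \<Rightarrow> 'c set \<Rightarrow> ('b \<Rightarrow> 'c) \<Rightarrow> 'b set \<Rightarrow> 'c set"
  where "coset_map H N f A = the_elem ((\<lambda>x. N #>\<^bsub>H\<^esub> f x) ` A)"

text \<open>Degrees are integers, so that all groups in negative degrees are trivial (the empty set is
  not a simplex) and no case distinction is needed in degree 0.\<close>

definition ordered_simplices :: "'a set set \<Rightarrow> int \<Rightarrow> 'a list set"
  where "ordered_simplices K q = {xs. distinct xs \<and> set xs \<in> K \<and> int (length xs) = q + 1}"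

text \<open>Passing to the quotient by these relations identifies orderings of a simplex that differ by
  an even permutation, and makes the two orientations of a simplex negatives of each other.\<close>

definition orientation_relations :: "'a set set \<Rightarrow> int \<Rightarrow> 'a list frag set"
  where "orientation_relations K q =
    generate (free_Abelian_group (ordered_simplices K q))
      {frag_of (permute_list p xs) - frag_cmul (sign p) (frag_of xs) | p xs.
        xs \<in> ordered_simplices K q \<and> p permutes {..<length xs}}"

definition chain_group :: "'a set set \<Rightarrow> int \<Rightarrow> 'a list frag set monoid"
  where "chain_group K q =
    free_Abelian_group (ordered_simplices K q) Mod orientation_relations K q"

text \<open>There is no augmentation: the boundary of a vertex is 0.\<close>

definition list_boundary :: "'a list \<Rightarrow> 'a list frag"
  where "list_boundary xs = (if length xs \<le> 1 then 0
    else \<Sum>i<length xs. frag_cmul ((-1) ^ i) (frag_of (take i xs @ drop (Suc i) xs)))"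

text \<open>The boundary map from degree \<open>q\<close> to degree \<open>q - 1\<close>.\<close>

definition boundary :: "'a set set \<Rightarrow> int \<Rightarrow> 'a list frag set \<Rightarrow> 'a list frag set"
  where "boundary K q =
    coset_map (free_Abelian_group (ordered_simplices K (q - 1))) (orientation_relations K (q - 1))
      (frag_extend list_boundary)"

text \<open>The chain map induced by an inclusion \<open>K \<subseteq> L\<close> of simplicial complexes.\<close>

definition chain_inclusion :: "'a set set \<Rightarrow> int \<Rightarrow> 'a list frag set \<Rightarrow> 'a list frag set"
  where "chain_inclusion L q =
    coset_map (free_Abelian_group (ordered_simplices L q)) (orientation_relations L q) (\<lambda>c. c)"


section \<open>Simplicial homology with integer coefficients\<close>

definition cycles :: "'a set set \<Rightarrow> int \<Rightarrow> 'a list frag set set"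
  where "cycles K q = kernel (chain_group K q) (chain_group K (q - 1)) (boundary K q)"

definition boundaries :: "'a set set \<Rightarrow> int \<Rightarrow> 'a list frag set set"
  where "boundaries K q = boundary K (q + 1) ` carrier (chain_group K (q + 1))"

definition simplicial_homology :: "'a set set \<Rightarrow> int \<Rightarrow> 'a list frag set set monoid"
  where "simplicial_homology K q = (chain_group K q)\<lparr>carrier := cycles K q\<rparr> Mod boundaries K q"

text \<open>The homomorphism \<open>H\<^sub>q(K) \<rightarrow> H\<^sub>q(L)\<close> induced by an inclusion \<open>K \<subseteq> L\<close>.\<close>

definition homology_inclusion ::
    "'a set set \<Rightarrow> int \<Rightarrow> 'a list frag set set \<Rightarrow> 'a list frag set set"
  where "homology_inclusion L q =
    coset_map (chain_group L q) (boundaries L q) (chain_inclusion L q)"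


section \<open>Simplicial cohomology with integer coefficients\<close>

text \<open>Homomorphisms are taken to be extensional, since \<^const>\<open>hom\<close> does not constrain values
  outside the carrier.\<close>

definition cochain_group :: "'a set set \<Rightarrow> int \<Rightarrow> ('a list frag set \<Rightarrow> int) monoid"
  where "cochain_group K q =
    \<lparr>carrier = hom (chain_group K q) integer_group \<inter> extensional (carrier (chain_group K q)),
     monoid.mult = (\<lambda>f g. \<lambda>c\<in>carrier (chain_group K q). f c + g c),
     one = (\<lambda>c\<in>carrier (chain_group K q). 0)\<rparr>"

text \<open>The coboundary map from degree \<open>q\<close> to degree \<open>q + 1\<close>.\<close>

definition coboundary ::
    "'a set set \<Rightarrow> int \<Rightarrow> ('a list frag set \<Rightarrow> int) \<Rightarrow> ('a list frag set \<Rightarrow> int)"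
  where "coboundary K q f = (\<lambda>c\<in>carrier (chain_group K (q + 1)). f (boundary K (q + 1) c))"

definition cocycles :: "'a set set \<Rightarrow> int \<Rightarrow> ('a list frag set \<Rightarrow> int) set"
  where "cocycles K q = kernel (cochain_group K q) (cochain_group K (q + 1)) (coboundary K q)"

definition coboundaries :: "'a set set \<Rightarrow> int \<Rightarrow> ('a list frag set \<Rightarrow> int) set"
  where "coboundaries K q = coboundary K (q - 1) ` carrier (cochain_group K (q - 1))"

definition simplicial_cohomology :: "'a set set \<Rightarrow> int \<Rightarrow> ('a list frag set \<Rightarrow> int) set monoid"
  where "simplicial_cohomology K q =
    (cochain_group K q)\<lparr>carrier := cocycles K q\<rparr> Mod coboundaries K q"

definition cochain_restriction ::
    "'a set set \<Rightarrow> 'a set set \<Rightarrow> int \<Rightarrow> ('a list frag set \<Rightarrow> int) \<Rightarrow> ('a list frag set \<Rightarrow> int)"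
  where "cochain_restriction K L q f =
    (\<lambda>c\<in>carrier (chain_group K q). f (chain_inclusion L q c))"

text \<open>The homomorphism \<open>H\<^sup>q(L) \<rightarrow> H\<^sup>q(K)\<close> induced by an inclusion \<open>K \<subseteq> L\<close>.\<close>

definition cohomology_restriction ::
    "'a set set \<Rightarrow> 'a set set \<Rightarrow> int \<Rightarrow>
      ('a list frag set \<Rightarrow> int) set \<Rightarrow> ('a list frag set \<Rightarrow> int) set"
  where "cohomology_restriction K L q =
    coset_map (cochain_group K q) (coboundaries K q) (cochain_restriction K L q)"


section \<open>Inverse and direct limits of groups\<close>

text \<open>A diagram of groups over a set \<open>I\<close> preordered by \<open>leq\<close> consists of groups \<open>G i\<close> and
  homomorphisms \<open>f i j\<close> from \<open>G i\<close> to \<open>G j\<close> whenever \<open>leq i j\<close>. The inverse limit is the group of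
  compatible families.\<close>

definition inverse_limit ::
    "'i set \<Rightarrow> ('i \<Rightarrow> 'i \<Rightarrow> bool) \<Rightarrow> ('i \<Rightarrow> 'g monoid) \<Rightarrow> ('i \<Rightarrow> 'i \<Rightarrow> 'g \<Rightarrow> 'g) \<Rightarrow> ('i \<Rightarrow> 'g) monoid"
  where "inverse_limit I leq G f = (product_group I G)
    \<lparr>carrier := {s \<in> carrier (product_group I G). \<forall>i\<in>I. \<forall>j\<in>I. leq i j \<longrightarrow> f i j (s i) = s j}\<rparr>"

text \<open>The direct limit, for \<open>I\<close> directed upwards by \<open>leq\<close>: the disjoint union of the groups, with
  two elements identified if they agree at some later stage. The product of two classes is computed
  at any common later stage of representatives.\<close>

definition eventually_equal ::
    "'i set \<Rightarrow> ('i \<Rightarrow> 'i \<Rightarrow> bool) \<Rightarrow> ('i \<Rightarrow> 'g monoid) \<Rightarrow> ('i \<Rightarrow> 'i \<Rightarrow> 'g \<Rightarrow> 'g) \<Rightarrow> ('i \<times> 'g) rel"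
  where "eventually_equal I leq G f = {((i, a), (j, b)).
    i \<in> I \<and> a \<in> carrier (G i) \<and> j \<in> I \<and> b \<in> carrier (G j) \<and>
    (\<exists>k\<in>I. leq i k \<and> leq j k \<and> f i k a = f j k b)}"

definition direct_limit ::
    "'i set \<Rightarrow> ('i \<Rightarrow> 'i \<Rightarrow> bool) \<Rightarrow> ('i \<Rightarrow> 'g monoid) \<Rightarrow> ('i \<Rightarrow> 'i \<Rightarrow> 'g \<Rightarrow> 'g) \<Rightarrow>
      ('i \<times> 'g) set monoid"
  where "direct_limit I leq G f =
    \<lparr>carrier = (SIGMA i:I. carrier (G i)) // eventually_equal I leq G f,
     monoid.mult = (\<lambda>C D. eventually_equal I leq G f ``
       {(k, f i k a \<otimes>\<^bsub>G k\<^esub> f j k b) | i a j b k.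
         (i, a) \<in> C \<and> (j, b) \<in> D \<and> k \<in> I \<and> leq i k \<and> leq j k}),
     one = eventually_equal I leq G f `` {(k, \<one>\<^bsub>G k\<^esub>) | k. k \<in> I}\<rparr>"


section \<open>Vietoris-Rips homology and cohomology\<close>

definition VR_homology :: "'a set \<Rightarrow> 'a rel set \<Rightarrow> int \<Rightarrow> ('a rel \<Rightarrow> 'a list frag set set) monoid"
  where "VR_homology X F q = inverse_limit F (\<subseteq>)
    (\<lambda>U. simplicial_homology (vietoris_rips_complex X U) q)
    (\<lambda>U U'. homology_inclusion (vietoris_rips_complex X U') q)"

text \<open>The diagram for cohomology is indexed by reverse inclusion: for \<open>U' \<subseteq> U\<close> there is a
  restriction map from the group at \<open>U\<close> to the group at \<open>U'\<close>.\<close>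

definition VR_cohomology ::
    "'a set \<Rightarrow> 'a rel set \<Rightarrow> int \<Rightarrow> ('a rel \<times> ('a list frag set \<Rightarrow> int) set) set monoid"
  where "VR_cohomology X F q = direct_limit F (\<supseteq>)
    (\<lambda>U. simplicial_cohomology (vietoris_rips_complex X U) q)
    (\<lambda>U U'. cohomology_restriction (vietoris_rips_complex X U') (vietoris_rips_complex X U) q)"

end

theory Submission
  imports Defs
begin

text \<open>Since \<open>E\<close> is symmetric, its Vietoris-Rips complex is the clique complex. As \<open>E\<close> is the least
  element of the filter it generates, the inverse limit over the filter is the group at \<open>E\<close>, and so is
  the direct limit, where the order is reversed. For this the induced maps must be functorial, which
  rests on the boundary of oriented chains being well defined. Orientation relations need only be
  checked for adjacent transpositions: there the two faces that omit one of the exchanged vertices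
  cancel, and all other faces are themselves related by an adjacent transposition.\<close>

section \<open>Maps between quotients\<close>

text \<open>The induced maps are given by \<open>coset_map\<close>, which takes
  \<open>the_elem\<close> of an image, so nothing can be computed with it before well-definedness is
  known; even that the inclusion of \<open>K\<close> into itself acts as the identity rests on this.
  Cosets are moreover nested: a homology class is a coset of boundaries in a group whose elements
  are themselves cosets of orientation relations. Hence the recurring pattern: a map carries the
  subgroup factored out in its domain into the one factored out in its target, and everything else
  is computed on representatives. Inclusions leave representatives of chains unchanged, so
  functoriality is immediate at that level. The two limits call for different inputs. Families are
  multiplied pointwise, so evaluation at an index respects products by definition. In the direct
  limit a product may be computed at any common later stage, so the transition maps must be
  homomorphisms and each group closed under multiplication.\<close>

lemma coset_map_r_coset:
  assumes "group G" "group H" "subgroup M G" "subgroup N H" "f \<in> hom G H" "f ` M \<subseteq> N"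
    "x \<in> carrier G"
  shows "coset_map H N f (M #>\<^bsub>G\<^esub> x) = N #>\<^bsub>H\<^esub> f x"
proof -
  interpret G: group G by fact
  interpret H: group H by fact
  interpret M: subgroup M G by fact
  interpret N: subgroup N H by fact
  \<comment> \<open>Moving \<open>x\<close> within its \<open>M\<close>-coset multiplies its image
    by an element of \<open>N\<close>, which the \<open>N\<close>-coset absorbs. So the image under
    \<open>the_elem\<close> is a singleton.\<close>
  have "N #>\<^bsub>H\<^esub> f (m \<otimes>\<^bsub>G\<^esub> x) = N #>\<^bsub>H\<^esub> f x" if "m \<in> M" for m
  proof -
    have fm: "f m \<in> N" and fx: "f x \<in> carrier H"
      using that assms by (auto simp: hom_def)
    have "N #>\<^bsub>H\<^esub> f (m \<otimes>\<^bsub>G\<^esub> x) = N #>\<^bsub>H\<^esub> f m \<otimes>\<^bsub>H\<^esub> f x"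
      using that assms hom_mult[OF assms(5)] by auto
    also have "\<dots> = (N #>\<^bsub>H\<^esub> f m) #>\<^bsub>H\<^esub> f x"
      using fm fx by (simp add: H.coset_mult_assoc N.subset)
    finally show ?thesis
      using fm by (simp add: H.coset_join2[OF _ N.subgroup_axioms])
  qed
  moreover have "M \<noteq> {}"
    using M.one_closed by blast
  ultimately have "(\<lambda>y. N #>\<^bsub>H\<^esub> f y) ` (M #>\<^bsub>G\<^esub> x) = {N #>\<^bsub>H\<^esub> f x}"
    by (auto simp: r_coset_def image_UN)
  then show ?thesis
    by (simp add: coset_map_def)
qed

text \<open>Cosets depend only on the multiplication of \<open>G\<close>, so shrinking the carrier
  to \<open>Y\<close> does not change them. Classes of cycles can thus be written as cosets in the
  whole chain group.\<close>

lemma carrier_subquotient: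
  "carrier (G\<lparr>carrier := Y\<rparr> Mod M) = (\<lambda>y. M #>\<^bsub>G\<^esub> y) ` Y"
  by (auto simp: FactGroup_def RCOSETS_def r_coset_def)

lemma mult_subquotient:
  "A \<otimes>\<^bsub>G\<lparr>carrier := Y\<rparr> Mod M\<^esub> B = A <#>\<^bsub>G\<^esub> B"
  by (simp add: FactGroup_def set_mult_def)

lemma set_mult_r_coset:
  assumes "comm_group G" "subgroup M G" "x \<in> carrier G" "y \<in> carrier G"
  shows "(M #>\<^bsub>G\<^esub> x) <#>\<^bsub>G\<^esub> (M #>\<^bsub>G\<^esub> y) = M #>\<^bsub>G\<^esub> x \<otimes>\<^bsub>G\<^esub> y"
proof -
  interpret comm_group G by fact
  interpret normal M G
    using assms normal_iff_subgroup by blast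
  show ?thesis
    using rcos_sum[OF assms(3,4)] .
qed

text \<open>The subquotient form serves every level at once: \<open>Y\<close> is the full carrier
  for chain groups, the cycles for homology and the cocycles for cohomology.\<close>

lemma coset_map_hom_subquotient:
  assumes "comm_group G" "comm_group H" "subgroup M G" "subgroup N H" "f \<in> hom G H" "f ` M \<subseteq> N"
    "Y \<subseteq> carrier G" "f ` Y \<subseteq> Z"
  shows "coset_map H N f \<in> hom (G\<lparr>carrier := Y\<rparr> Mod M) (H\<lparr>carrier := Z\<rparr> Mod N)"
proof -
  interpret G: comm_group G by fact
  interpret H: comm_group H by fact
  note cm = coset_map_r_coset[OF G.group_axioms H.group_axioms assms(3-6)]
  have fc: "f x \<in> carrier H" if "x \<in> carrier G" for x
    using assms(5) that by (auto simp: hom_def)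
  show ?thesis
  proof (rule homI)
    fix A assume "A \<in> carrier (G\<lparr>carrier := Y\<rparr> Mod M)"
    then obtain y where "y \<in> Y" "A = M #>\<^bsub>G\<^esub> y"
      by (auto simp: carrier_subquotient)
    with assms(7,8) show "coset_map H N f A \<in> carrier (H\<lparr>carrier := Z\<rparr> Mod N)"
      by (auto simp: carrier_subquotient cm subset_eq)
  next
    fix A B assume "A \<in> carrier (G\<lparr>carrier := Y\<rparr> Mod M)" "B \<in> carrier (G\<lparr>carrier := Y\<rparr> Mod M)"
    then obtain y z where "y \<in> Y" "A = M #>\<^bsub>G\<^esub> y" "z \<in> Y" "B = M #>\<^bsub>G\<^esub> z"
      by (auto simp: carrier_subquotient)
    moreover from this have "y \<in> carrier G" "z \<in> carrier G"
      using assms(7) by auto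
    ultimately show "coset_map H N f (A \<otimes>\<^bsub>G\<lparr>carrier := Y\<rparr> Mod M\<^esub> B)
        = coset_map H N f A \<otimes>\<^bsub>H\<lparr>carrier := Z\<rparr> Mod N\<^esub> coset_map H N f B"
      using assms by (simp add: mult_subquotient set_mult_r_coset cm fc hom_mult[OF assms(5)] del: mult_FactGroup)
  qed
qed

lemma subquotient_mult_closed:
  assumes "comm_group G" "subgroup M G" "subgroup Y G"
    and "A \<in> carrier (G\<lparr>carrier := Y\<rparr> Mod M)" "B \<in> carrier (G\<lparr>carrier := Y\<rparr> Mod M)"
  shows "A \<otimes>\<^bsub>G\<lparr>carrier := Y\<rparr> Mod M\<^esub> B \<in> carrier (G\<lparr>carrier := Y\<rparr> Mod M)"
proof -
  obtain y z where "y \<in> Y" "A = M #>\<^bsub>G\<^esub> y" "z \<in> Y" "B = M #>\<^bsub>G\<^esub> z"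
    using assms(4,5) by (auto simp: carrier_subquotient)
  then show ?thesis
    using assms by (auto simp: carrier_subquotient mult_subquotient set_mult_r_coset subgroup.mem_carrier
        subgroup.m_closed simp del: mult_FactGroup)
qed


section \<open>Limits over a set with a least or greatest index\<close>

text \<open>The isomorphism is evaluation at \<open>i0\<close>. A compatible family is determined by
  its value there, and any value \<open>a\<close> extends to the family of its images
  \<open>f i0 i a\<close>.\<close>

lemma inverse_limit_least_iso:
  assumes i0: "i0 \<in> I" "\<And>i. i \<in> I \<Longrightarrow> leq i0 i"
    and f_in: "\<And>i j a. i \<in> I \<Longrightarrow> j \<in> I \<Longrightarrow> leq i j \<Longrightarrow> a \<in> carrier (G i) \<Longrightarrow> f i j a \<in> carrier (G j)"
    and f_id: "\<And>i a. i \<in> I \<Longrightarrow> a \<in> carrier (G i) \<Longrightarrow> f i i a = a"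
    and f_comp: "\<And>i j k a. i \<in> I \<Longrightarrow> j \<in> I \<Longrightarrow> k \<in> I \<Longrightarrow> leq i j \<Longrightarrow> leq j k \<Longrightarrow>
      a \<in> carrier (G i) \<Longrightarrow> f j k (f i j a) = f i k a"
  shows "inverse_limit I leq G f \<cong> G i0"
proof -
  let ?L = "inverse_limit I leq G f"
  have carr: "carrier ?L =
      {s \<in> Pi\<^sub>E I (\<lambda>i. carrier (G i)). \<forall>i\<in>I. \<forall>j\<in>I. leq i j \<longrightarrow> f i j (s i) = s j}"
    by (simp add: inverse_limit_def)
  have "(\<lambda>s. s i0) \<in> hom ?L (G i0)"
    using i0 by (auto simp: hom_def carr) (simp add: inverse_limit_def)
  moreover have "bij_betw (\<lambda>s. s i0) (carrier ?L) (carrier (G i0))"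
    unfolding bij_betw_def
  proof
    show "inj_on (\<lambda>s. s i0) (carrier ?L)"
    proof
      fix s t assume st: "s \<in> carrier ?L" "t \<in> carrier ?L" "s i0 = t i0"
      have determined: "f i0 i (u i0) = u i" if "u \<in> carrier ?L" "i \<in> I" for u i
        using that i0 by (simp add: carr)
      have "s i = t i" if "i \<in> I" for i
        using determined[OF st(1) that] determined[OF st(2) that] st(3) by simp
      then show "s = t"
        using st unfolding carr by (auto intro: PiE_ext)
    qed
    show "(\<lambda>s. s i0) ` carrier ?L = carrier (G i0)"
    proof
      show "(\<lambda>s. s i0) ` carrier ?L \<subseteq> carrier (G i0)"
        using i0 by (auto simp: carr)
      show "carrier (G i0) \<subseteq> (\<lambda>s. s i0) ` carrier ?L"
      proof
        fix a assume a: "a \<in> carrier (G i0)"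
        have "(\<lambda>i\<in>I. f i0 i a) \<in> carrier ?L"
          using a i0 by (auto simp: carr f_in f_comp)
        moreover have "a = (\<lambda>i\<in>I. f i0 i a) i0"
          using a i0 f_id by simp
        ultimately show "a \<in> (\<lambda>s. s i0) ` carrier ?L"
          by blast
      qed
    qed
  qed
  ultimately show ?thesis
    by (auto simp: is_iso_def iso_def)
qed

text \<open>Pushing every pair \<open>(i, a)\<close> forward to stage \<open>i0\<close> is the map
  \<open>g\<close>. The relation \<open>eventually_equal\<close> is exactly equality of
  \<open>g\<close>-values, so the elements of the limit are the fibres of \<open>g\<close> and the
  isomorphism sends a fibre to its value.\<close>

lemma direct_limit_greatest_iso:
  fixes I :: "'i set" and G :: "'i \<Rightarrow> 'g monoid"
  assumes i0: "i0 \<in> I" "\<And>i. i \<in> I \<Longrightarrow> leq i i0"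
    and f_hom: "\<And>i j. i \<in> I \<Longrightarrow> j \<in> I \<Longrightarrow> leq i j \<Longrightarrow> f i j \<in> hom (G i) (G j)"
    and f_id: "\<And>i a. i \<in> I \<Longrightarrow> a \<in> carrier (G i) \<Longrightarrow> f i i a = a"
    and f_comp: "\<And>i j k a. i \<in> I \<Longrightarrow> j \<in> I \<Longrightarrow> k \<in> I \<Longrightarrow> leq i j \<Longrightarrow> leq j k \<Longrightarrow>
      a \<in> carrier (G i) \<Longrightarrow> f j k (f i j a) = f i k a"
    and mult_closed: "\<And>i a b. i \<in> I \<Longrightarrow> a \<in> carrier (G i) \<Longrightarrow> b \<in> carrier (G i) \<Longrightarrow>
      a \<otimes>\<^bsub>G i\<^esub> b \<in> carrier (G i)"
  shows "direct_limit I leq G f \<cong> G i0"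
proof -
  define S where "S = (SIGMA i:I. carrier (G i))"
  define g where "g = (\<lambda>(i, a). f i i0 a)"
  let ?R = "eventually_equal I leq G f"
  let ?L = "direct_limit I leq G f"
  have f_in: "f i j a \<in> carrier (G j)" if "i \<in> I" "j \<in> I" "leq i j" "a \<in> carrier (G i)" for i j a
    using f_hom[OF that(1-3)] that(4) by (auto simp: hom_def)
  have R: "?R = {(x, y). x \<in> S \<and> y \<in> S \<and> g x = g y}"
  proof -
    \<comment> \<open>Agreement at some stage \<open>k\<close> persists when pushed on to
      \<open>i0\<close>; conversely \<open>i0\<close> is itself an admissible
      \<open>k\<close>.\<close>
    have "(\<exists>k\<in>I. leq i k \<and> leq j k \<and> f i k a = f j k b) \<longleftrightarrow> f i i0 a = f j i0 b"
      if "i \<in> I" "j \<in> I" "a \<in> carrier (G i)" "b \<in> carrier (G j)" for i j a b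
      using that i0 f_comp by metis
    note iff = this
    show ?thesis
    proof (rule Set.set_eqI)
      fix x :: "('i \<times> 'g) \<times> ('i \<times> 'g)"
      obtain i a j b where "x = ((i, a), (j, b))"
        by (metis surj_pair)
      then show "x \<in> ?R \<longleftrightarrow> x \<in> {(x, y). x \<in> S \<and> y \<in> S \<and> g x = g y}"
        using iff[of i j a b] by (simp add: eventually_equal_def S_def g_def) blast
    qed
  qed
  \<comment> \<open>Products in the limit are defined as the \<open>?R\<close>-image of a whole set
    of representatives; this evaluates such an image once \<open>g\<close> is known to be constant
    on the set.\<close>
  have class_eq: "?R `` T = {y \<in> S. g y = c}" if "T \<subseteq> S" "T \<noteq> {}" "\<And>x. x \<in> T \<Longrightarrow> g x = c" for T c
    using that by (fastforce simp: R)
  have g_in: "g x \<in> carrier (G i0)" if "x \<in> S" for x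
    using that i0 f_in by (auto simp: S_def g_def)
  have g_i0: "(i0, c) \<in> S" "g (i0, c) = c" if "c \<in> carrier (G i0)" for c
    using that i0 f_id by (auto simp: S_def g_def)
  have carr: "carrier ?L = (\<lambda>c. {y \<in> S. g y = c}) ` carrier (G i0)"
  proof -
    have "carrier ?L = (\<lambda>x. ?R `` {x}) ` S"
      by (auto simp: direct_limit_def quotient_def S_def)
    also have "\<dots> = (\<lambda>x. {y \<in> S. g y = g x}) ` S"
      by (intro image_cong) (auto simp: R)
    also have "\<dots> = (\<lambda>c. {y \<in> S. g y = c}) ` carrier (G i0)"
    proof -
      have "carrier (G i0) = g ` S"
        using g_in g_i0 by (force simp: image_iff)
      then show ?thesis
        by (simp add: image_image)
    qed
    finally show ?thesis .
  qed
  define h where "h = (\<lambda>C. the_elem (g ` C))"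
  have h: "h {y \<in> S. g y = c} = c" if "c \<in> carrier (G i0)" for c
  proof -
    have "g ` {y \<in> S. g y = c} = {c}"
      using g_i0[OF that] by force
    then show ?thesis
      by (simp add: h_def)
  qed
  have mult: "{y \<in> S. g y = c} \<otimes>\<^bsub>?L\<^esub> {y \<in> S. g y = d} = {y \<in> S. g y = c \<otimes>\<^bsub>G i0\<^esub> d}"
    if c: "c \<in> carrier (G i0)" and d: "d \<in> carrier (G i0)" for c d
  proof -
    let ?T = "{(k, f i k a \<otimes>\<^bsub>G k\<^esub> f j k b) | i a j b k.
         (i, a) \<in> {y \<in> S. g y = c} \<and> (j, b) \<in> {y \<in> S. g y = d} \<and> k \<in> I \<and> leq i k \<and> leq j k}"
    have T: "x \<in> S \<and> g x = c \<otimes>\<^bsub>G i0\<^esub> d" if "x \<in> ?T" for x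
    proof -
      obtain i a j b k where x: "x = (k, f i k a \<otimes>\<^bsub>G k\<^esub> f j k b)"
        and i: "i \<in> I" "a \<in> carrier (G i)" "f i i0 a = c"
        and j: "j \<in> I" "b \<in> carrier (G j)" "f j i0 b = d"
        and k: "k \<in> I" "leq i k" "leq j k"
        using \<open>x \<in> ?T\<close> by (auto simp: S_def g_def)
      have in_k: "f i k a \<in> carrier (G k)" "f j k b \<in> carrier (G k)"
        using i j k f_in by auto
      then have "x \<in> S"
        using x k mult_closed by (auto simp: S_def)
      moreover have "g x = f k i0 (f i k a) \<otimes>\<^bsub>G i0\<^esub> f k i0 (f j k b)"
        using x in_k hom_mult[OF f_hom[OF k(1) i0(1) i0(2)[OF k(1)]]] by (simp add: g_def)
      ultimately show ?thesis
        using i j k i0 f_comp by simp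
    qed
    \<comment> \<open>The set of representatives must be nonempty for \<open>class_eq\<close>;
      taking both factors and the common stage at \<open>i0\<close> provides a member.\<close>
    have "(i0, f i0 i0 c \<otimes>\<^bsub>G i0\<^esub> f i0 i0 d) \<in> ?T"
      using g_i0[OF c] g_i0[OF d] i0 by blast
    then have "?R `` ?T = {y \<in> S. g y = c \<otimes>\<^bsub>G i0\<^esub> d}"
      using T by (intro class_eq) blast+
    then show ?thesis
      by (simp add: direct_limit_def)
  qed
  have "h \<in> hom ?L (G i0)"
    using h mult mult_closed i0 by (auto simp: hom_def carr)
  moreover have "bij_betw h (carrier ?L) (carrier (G i0))"
    unfolding carr by (rule bij_betw_byWitness[where f' = "\<lambda>c. {y \<in> S. g y = c}"]) (auto simp: h)
  ultimately show ?thesis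
    by (auto simp: is_iso_def iso_def)
qed


section \<open>Chain groups\<close>

lemma orientation_relations_subgroup:
  "subgroup (orientation_relations K q) (free_Abelian_group (ordered_simplices K q))"
proof -
  have "permute_list p xs \<in> ordered_simplices K q"
    if "xs \<in> ordered_simplices K q" "p permutes {..<length xs}" for p xs
    using that by (simp add: ordered_simplices_def)
  then show ?thesis
    unfolding orientation_relations_def
    by (intro group.generate_is_subgroup)
       (auto dest!: subsetD[OF keys_diff] subsetD[OF keys_cmul])
qed

text \<open>The shape of the right-hand side lets the lemmas on subquotients apply to chain groups.\<close>

lemma chain_group_eq:
  "chain_group K q = (free_Abelian_group (ordered_simplices K q))
    \<lparr>carrier := carrier (free_Abelian_group (ordered_simplices K q))\<rparr> Mod orientation_relations K q"
  by (simp add: chain_group_def)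

lemma comm_group_chain_group: "comm_group (chain_group K q)"
  unfolding chain_group_def
  by (intro comm_group.abelian_FactGroup orientation_relations_subgroup
      abelian_free_Abelian_group)

text \<open>An induction principle resting on two facts: transpositions generate the permutations of
  a finite set, and a longer transposition is a conjugate of a shorter one by an adjacent one.
  Composition is restricted to permutations of \<open>{..<n}\<close>, where the rules for
  \<open>sign\<close> and \<open>permute_list\<close> apply.\<close>

lemma adjacent_transpositions_generate:
  assumes "p permutes {..<n}"
    and id: "P id"
    and comp: "\<And>p p'. p permutes {..<n} \<Longrightarrow> p' permutes {..<n} \<Longrightarrow> P p \<Longrightarrow> P p' \<Longrightarrow> P (p \<circ> p')"
    and adj: "\<And>i. Suc i < n \<Longrightarrow> P (transpose i (Suc i))"
  shows "P (p :: nat \<Rightarrow> nat)"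
proof -
  have lt: "P (transpose a b)" if "a < b" "b < n" for a b
    using that
  proof (induction b)
    case (Suc b)
    show ?case
    proof (cases "a = b")
      case True
      then show ?thesis using Suc adj by simp
    next
      case False
      \<comment> \<open>Conjugation by \<open>transpose b (Suc b)\<close> fixes \<open>a\<close>,
        which is below \<open>b\<close>, and renames \<open>b\<close> to
        \<open>Suc b\<close>.\<close>
      have "transpose a (Suc b) = transpose b (Suc b) \<circ> (transpose a b \<circ> transpose b (Suc b))"
        using False Suc.prems by (auto simp: transpose_def fun_eq_iff)
      moreover have "P (transpose a b)" "P (transpose b (Suc b))"
        using False Suc adj by auto
      moreover have "transpose a b permutes {..<n}" "transpose b (Suc b) permutes {..<n}"
        using Suc.prems by (auto intro!: permutes_swap_id)
      ultimately show ?thesis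
        by (metis comp permutes_compose)
    qed
  qed simp
  have tr: "P (transpose a b)" if "a < n" "b < n" for a b
    using that lt[of a b] lt[of b a] id
    by (cases a b rule: linorder_cases) (auto simp: transpose_commute)
  have "P p \<and> p permutes {..<n}"
    using finite_lessThan assms(1)
  proof (induction rule: permutes_rev_induct)
    case id
    show ?case using \<open>P id\<close> permutes_id by blast
  next
    case (swap a b p)
    moreover have "transpose a b permutes {..<n}"
      using swap by (auto intro!: permutes_swap_id)
    ultimately show ?case
      by (metis comp tr permutes_compose lessThan_iff)
  qed
  then show ?thesis ..
qed

lemma orientation_relations_zero: "0 \<in> orientation_relations K q"
  using subgroup.one_closed[OF orientation_relations_subgroup] by simp

lemma orientation_relations_add:
  "a \<in> orientation_relations K q \<Longrightarrow> b \<in> orientation_relations K q \<Longrightarrow>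
    a + b \<in> orientation_relations K q"
  using subgroup.m_closed[OF orientation_relations_subgroup] by fastforce

lemma orientation_relations_cmul:
  assumes "a \<in> orientation_relations K q"
  shows "frag_cmul n a \<in> orientation_relations K q"
proof -
  \<comment> \<open>For chains supported on the generators, integer powers in the free abelian group
    are the multiples \<open>frag_cmul n a\<close>, so closure of subgroups under powers
    applies.\<close>
  have "Poly_Mapping.keys a \<subseteq> ordered_simplices K q"
    using subgroup.mem_carrier[OF orientation_relations_subgroup assms] by simp
  then show ?thesis
    using group.subgroup_int_pow_closed[OF group_free_Abelian_group orientation_relations_subgroup assms,
        of n]
    by simp
qed

lemma orientation_relations_sum:
  "(\<And>i. i \<in> I \<Longrightarrow> f i \<in> orientation_relations K q) \<Longrightarrow> sum f I \<in> orientation_relations K q"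
  by (induction I rule: infinite_finite_induct)
     (auto intro: orientation_relations_zero orientation_relations_add)

text \<open>A homomorphism maps the subgroup generated by a set onto the subgroup generated by its
  image, so only generators have to be checked. This is applied to the boundary and to
  inclusions.\<close>

lemma hom_image_orientation_relations:
  assumes "group H" "subgroup N H" "f \<in> hom (free_Abelian_group (ordered_simplices K q)) H"
    and "\<And>p xs. xs \<in> ordered_simplices K q \<Longrightarrow> p permutes {..<length xs} \<Longrightarrow>
      f (frag_of (permute_list p xs) - frag_cmul (sign p) (frag_of xs)) \<in> N"
  shows "f ` orientation_relations K q \<subseteq> N"
proof -
  let ?F = "free_Abelian_group (ordered_simplices K q)"
  let ?A = "{frag_of (permute_list p xs) - frag_cmul (sign p) (frag_of xs) | p xs.
    xs \<in> ordered_simplices K q \<and> p permutes {..<length xs}}"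
  interpret group_hom ?F H f
    using assms by (simp add: group_hom_def group_hom_axioms_def)
  have "?A \<subseteq> orientation_relations K q"
    unfolding orientation_relations_def by (auto intro: generate.incl)
  then have "?A \<subseteq> carrier ?F"
    using subgroup.subset[OF orientation_relations_subgroup] by blast
  then have "f ` orientation_relations K q = generate H (f ` ?A)"
    unfolding orientation_relations_def by (simp only: generate_img)
  moreover have "f ` ?A \<subseteq> N"
    using assms(4) by blast
  ultimately show ?thesis
    using assms(2) H.generate_subgroup_incl by simp
qed


section \<open>The boundary map\<close>

text \<open>Replaces index permutations by a splitting of the list around the exchanged entries, a
  form in which faces are easy to compute.\<close>

lemma permute_list_transpose_adjacent:
  "permute_list (transpose (length us) (Suc (length us))) (us @ x # y # vs) = us @ y # x # vs"
proof (rule nth_equalityI)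
  let ?a = "length us" and ?xs = "us @ x # y # vs"
  fix i assume "i < length (permute_list (transpose ?a (Suc ?a)) ?xs)"
  then have i: "i < length ?xs"
    by simp
  show "permute_list (transpose ?a (Suc ?a)) ?xs ! i = (us @ y # x # vs) ! i"
  proof (cases "Suc ?a < i")
    case True
    then obtain m where "i = Suc (Suc ?a + m)"
      using less_imp_Suc_add by blast
    then show ?thesis
      using i by (simp add: permute_list_def nth_append transpose_def del: upt_Suc)
  next
    case False
    then consider "i < ?a" | "i = ?a" | "i = Suc ?a"
      by linarith
    then show ?thesis
      using i by cases (simp_all add: permute_list_def nth_append transpose_def del: upt_Suc)
  qed
qed simp

text \<open>A transposition has sign -1, so the difference in the defining relation becomes a
  sum.\<close>

lemma swap_adjacent_orientation_relation:
  assumes "us @ x # y # vs \<in> ordered_simplices K q"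
  shows "frag_of (us @ y # x # vs) + frag_of (us @ x # y # vs) \<in> orientation_relations K q"
proof -
  let ?p = "transpose (length us) (Suc (length us))" and ?xs = "us @ x # y # vs"
  have "?p permutes {..<length ?xs}"
    by (intro permutes_swap_id) auto
  then have "frag_of (permute_list ?p ?xs) - frag_cmul (sign ?p) (frag_of ?xs)
      \<in> orientation_relations K q"
    unfolding orientation_relations_def using assms by (intro generate.incl) blast
  then show ?thesis
    by (simp add: permute_list_transpose_adjacent sign_swap_id)
qed

text \<open>Length greater than 1 keeps the face nonempty, as every simplex must be.\<close>

lemma face_in_ordered_simplices:
  assumes "simplicial_complex K" "xs \<in> ordered_simplices K q" "k < length xs" "1 < length xs"
  shows "take k xs @ drop (Suc k) xs \<in> ordered_simplices K (q - 1)"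
proof -
  let ?ys = "take k xs @ drop (Suc k) xs"
  have xs: "distinct xs" "set xs \<in> K" "int (length xs) = q + 1"
    using assms(2) by (auto simp: ordered_simplices_def)
  have len: "length ?ys = length xs - 1"
    using assms(3) by simp
  then have "?ys \<noteq> []"
    using assms(4) by (metis diff_is_0_eq list.size(3) not_le)
  moreover have "set ?ys \<subseteq> set xs"
    by (auto dest: in_set_takeD in_set_dropD)
  ultimately have "set ?ys \<in> K"
    using assms(1) xs(2) unfolding simplicial_complex_def by (metis set_empty)
  moreover have "distinct ?ys"
    using xs(1) set_take_disj_set_drop_if_distinct[of xs k "Suc k"] by simp
  ultimately show ?thesis
    using len xs(3) assms(4) by (simp add: ordered_simplices_def)
qed

lemma list_boundary_swap_adjacent:
  assumes K: "simplicial_complex K" and xs: "us @ x # y # vs \<in> ordered_simplices K q"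
  shows "list_boundary (us @ y # x # vs) + list_boundary (us @ x # y # vs)
    \<in> orientation_relations K (q - 1)"
proof -
  let ?xs = "us @ x # y # vs" and ?ys = "us @ y # x # vs"
  let ?n = "length ?xs" and ?a = "length us"
  let ?del = "\<lambda>zs k. frag_of (take k zs @ drop (Suc k) zs)"
  define t where "t k = frag_cmul ((-1) ^ k) (?del ?ys k + ?del ?xs k)" for k
  have "list_boundary ?ys + list_boundary ?xs = (\<Sum>k<?n. t k)"
    by (simp add: list_boundary_def t_def frag_cmul_distrib2 sum.distrib)
  also have "\<dots> = t ?a + t (Suc ?a) + (\<Sum>k\<in>{..<?n} - {?a, Suc ?a}. t k)"
  proof -
    have "{..<?n} = {?a, Suc ?a} \<union> ({..<?n} - {?a, Suc ?a})"
      by auto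
    then have "sum t {..<?n} = sum t {?a, Suc ?a} + sum t ({..<?n} - {?a, Suc ?a})"
      by (metis Diff_disjoint finite_Diff finite_lessThan finite.emptyI finite.insertI
          sum.union_disjoint)
    then show ?thesis
      by simp
  qed
  \<comment> \<open>Deleting position \<open>?a\<close> from one list gives the same result as
    deleting position \<open>Suc ?a\<close> from the other. Both terms therefore contain the same
    two faces, with opposite signs.\<close>
  also have "t ?a + t (Suc ?a) = 0"
    by (rule poly_mapping_eqI) (simp add: t_def lookup_add algebra_simps)
  also have "0 + (\<Sum>k\<in>{..<?n} - {?a, Suc ?a}. t k) \<in> orientation_relations K (q - 1)"
    unfolding add_0_left
  proof (rule orientation_relations_sum)
    fix k assume k: "k \<in> {..<?n} - {?a, Suc ?a}"
    have face: "take k ?xs @ drop (Suc k) ?xs \<in> ordered_simplices K (q - 1)"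
      using k by (intro face_in_ordered_simplices[OF K xs]) auto
    have "?del ?ys k + ?del ?xs k \<in> orientation_relations K (q - 1)"
    proof (cases "k < ?a")
      case True
      then show ?thesis
        using swap_adjacent_orientation_relation[of "take k us @ drop (Suc k) us" x y vs K "q - 1"] face
        by simp
    next
      case False
      then have "Suc ?a < k"
        using k by auto
      \<comment> \<open>Here \<open>m\<close> is the position within \<open>vs\<close> of the
        deleted entry.\<close>
      then obtain m where "k = Suc (Suc ?a + m)"
        using less_imp_Suc_add by blast
      then have "take k (us @ a # b # vs) = us @ a # b # take m vs"
        "drop (Suc k) (us @ a # b # vs) = drop (Suc m) vs" for a b
        by (simp_all add: drop_Cons')
      then show ?thesis
        using swap_adjacent_orientation_relation[of us x y "take m vs @ drop (Suc m) vs" K "q - 1"] face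
        by simp
    qed
    then show "t k \<in> orientation_relations K (q - 1)"
      unfolding t_def by (rule orientation_relations_cmul)
  qed
  finally show ?thesis .
qed

lemma list_boundary_permute_list:
  assumes K: "simplicial_complex K" and xs: "xs \<in> ordered_simplices K q"
    and p: "p permutes {..<length xs}"
  shows "list_boundary (permute_list p xs) - frag_cmul (sign p) (list_boundary xs)
    \<in> orientation_relations K (q - 1)"
proof -
  \<comment> \<open>The statement quantifies over all ordered simplices of this length because, for
    a composite, the hypothesis on the second factor is applied to the list already permuted by the
    first.\<close>
  define P where "P p \<longleftrightarrow> (\<forall>ys \<in> ordered_simplices K q. length ys = length xs \<longrightarrow>
    list_boundary (permute_list p ys) - frag_cmul (sign p) (list_boundary ys)
      \<in> orientation_relations K (q - 1))" for p
  have "P p"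
    using p
  proof (rule adjacent_transpositions_generate)
    show "P id"
      by (simp add: P_def orientation_relations_zero sign_id)
  next
    fix r r' assume r: "r permutes {..<length xs}" "r' permutes {..<length xs}" "P r" "P r'"
    show "P (r \<circ> r')"
      unfolding P_def
    proof (intro ballI impI)
      fix ys assume ys: "ys \<in> ordered_simplices K q" "length ys = length xs"
      let ?zs = "permute_list r ys"
      have zs: "?zs \<in> ordered_simplices K q" "length ?zs = length xs"
        using ys r(1) by (auto simp: ordered_simplices_def)
      \<comment> \<open>A telescoping sum: the boundary of the intermediate list \<open>?zs\<close>
        cancels, leaving the relation for \<open>r \<circ> r'\<close>. Note that
        \<open>permute_list\<close> reverses the order of composition, while signs commute.\<close>
      have "list_boundary (permute_list r' ?zs) - frag_cmul (sign r') (list_boundary ?zs)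
          + frag_cmul (sign r') (list_boundary ?zs - frag_cmul (sign r) (list_boundary ys))
          \<in> orientation_relations K (q - 1)"
        using r(3,4) ys zs unfolding P_def
        by (intro orientation_relations_add orientation_relations_cmul) auto
      moreover have "permute_list (r \<circ> r') ys = permute_list r' ?zs"
        using r ys by (simp add: permute_list_compose)
      moreover have "sign (r \<circ> r') = sign r' * sign r"
        using r by (simp add: sign_compose permutes_imp_permutation[OF finite_lessThan] mult.commute)
      moreover have "list_boundary (permute_list r' ?zs) - frag_cmul (sign r') (list_boundary ?zs)
          + frag_cmul (sign r') (list_boundary ?zs - frag_cmul (sign r) (list_boundary ys))
          = list_boundary (permute_list r' ?zs) - frag_cmul (sign r' * sign r) (list_boundary ys)"
        by (rule poly_mapping_eqI) (simp add: lookup_minus lookup_add algebra_simps)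
      ultimately show "list_boundary (permute_list (r \<circ> r') ys)
          - frag_cmul (sign (r \<circ> r')) (list_boundary ys) \<in> orientation_relations K (q - 1)"
        by (simp only:)
    qed
  next
    fix i assume i: "Suc i < length xs"
    show "P (transpose i (Suc i))"
      unfolding P_def
    proof (intro ballI impI)
      fix ys assume ys: "ys \<in> ordered_simplices K q" "length ys = length xs"
      define us x y vs where "us = take i ys" "x = ys ! i" "y = ys ! Suc i" "vs = drop (Suc (Suc i)) ys"
      have eq: "ys = us @ x # y # vs" and len: "length us = i"
        using i ys(2) by (simp_all add: us_x_y_vs_def Cons_nth_drop_Suc id_take_nth_drop[symmetric])
      show "list_boundary (permute_list (transpose i (Suc i)) ys)
          - frag_cmul (sign (transpose i (Suc i))) (list_boundary ys)
          \<in> orientation_relations K (q - 1)"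
        using list_boundary_swap_adjacent[OF K ys(1)[unfolded eq]]
          permute_list_transpose_adjacent[of us x y vs]
        by (simp add: len sign_swap_id flip: eq)
    qed
  qed
  then show ?thesis
    using xs by (simp add: P_def)
qed

lemma frag_extend_list_boundary_hom:
  assumes "simplicial_complex K"
  shows "frag_extend list_boundary \<in> hom (free_Abelian_group (ordered_simplices K q))
    (free_Abelian_group (ordered_simplices K (q - 1)))"
proof (rule homI)
  fix c assume c: "c \<in> carrier (free_Abelian_group (ordered_simplices K q))"
  \<comment> \<open>A vertex has zero boundary by definition of \<open>list_boundary\<close>; its
    only candidate face would be the empty list, which is not an ordered simplex.\<close>
  have "Poly_Mapping.keys (list_boundary xs) \<subseteq> ordered_simplices K (q - 1)"
    if xs: "xs \<in> ordered_simplices K q" for xs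
  proof (cases "length xs \<le> 1")
    case False
    then have "list_boundary xs
        = (\<Sum>i<length xs. frag_cmul ((-1) ^ i) (frag_of (take i xs @ drop (Suc i) xs)))"
      by (simp add: list_boundary_def)
    also have "Poly_Mapping.keys \<dots>
        \<subseteq> (\<Union>i<length xs. Poly_Mapping.keys (frag_cmul ((-1) ^ i)
            (frag_of (take i xs @ drop (Suc i) xs))))"
      by (rule keys_sum)
    also have "\<dots> \<subseteq> ordered_simplices K (q - 1)"
      using face_in_ordered_simplices[OF assms xs] False by (auto dest!: subsetD[OF keys_cmul])
    finally show ?thesis .
  qed (simp add: list_boundary_def)
  then show "frag_extend list_boundary c \<in> carrier (free_Abelian_group (ordered_simplices K (q - 1)))"
    using c keys_frag_extend[of list_boundary c] by fastforce
qed (simp add: frag_extend_add)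

lemma frag_extend_list_boundary_orientation_relations:
  assumes "simplicial_complex K"
  shows "frag_extend list_boundary ` orientation_relations K q \<subseteq> orientation_relations K (q - 1)"
  by (intro hom_image_orientation_relations[OF group_free_Abelian_group orientation_relations_subgroup
        frag_extend_list_boundary_hom[OF assms]])
     (simp add: frag_extend_diff frag_extend_cmul list_boundary_permute_list[OF assms])

lemma boundary_r_coset:
  assumes "simplicial_complex K" "Poly_Mapping.keys c \<subseteq> ordered_simplices K q"
  shows "boundary K q (orientation_relations K q #>\<^bsub>free_Abelian_group (ordered_simplices K q)\<^esub> c)
    = orientation_relations K (q - 1) #>\<^bsub>free_Abelian_group (ordered_simplices K (q - 1))\<^esub>
        frag_extend list_boundary c"
  unfolding boundary_def
  using assms
  by (intro coset_map_r_coset orientation_relations_subgroup frag_extend_list_boundary_hom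
      frag_extend_list_boundary_orientation_relations) auto

lemma boundary_hom:
  assumes "simplicial_complex K"
  shows "boundary K q \<in> hom (chain_group K q) (chain_group K (q - 1))"
  unfolding chain_group_eq boundary_def
  by (intro coset_map_hom_subquotient abelian_free_Abelian_group orientation_relations_subgroup
      frag_extend_list_boundary_hom[OF assms] frag_extend_list_boundary_orientation_relations[OF assms]
      hom_carrier[OF frag_extend_list_boundary_hom[OF assms]] order_refl)


section \<open>Maps induced by inclusions\<close>

lemma ordered_simplices_mono: "K \<subseteq> L \<Longrightarrow> ordered_simplices K q \<subseteq> ordered_simplices L q"
  by (auto simp: ordered_simplices_def)

lemma identity_hom_free_Abelian_group:
  assumes "S \<subseteq> T"
  shows "(\<lambda>c. c) \<in> hom (free_Abelian_group S) (free_Abelian_group T)"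
  using assms by (auto intro!: homI)

text \<open>The two subgroups are generated inside different free abelian groups, so the inclusion
  is obtained by viewing the identity as a homomorphism from one group to the other.\<close>

lemma orientation_relations_mono:
  assumes "K \<subseteq> L"
  shows "orientation_relations K q \<subseteq> orientation_relations L q"
proof -
  have "(\<lambda>c. c) ` orientation_relations K q \<subseteq> orientation_relations L q"
  proof (rule hom_image_orientation_relations[OF group_free_Abelian_group
        orientation_relations_subgroup identity_hom_free_Abelian_group[OF ordered_simplices_mono[OF assms]]])
    fix p and xs :: "'a list"
    assume "xs \<in> ordered_simplices K q" "p permutes {..<length xs}"
    then show "frag_of (permute_list p xs) - frag_cmul (sign p) (frag_of xs)
        \<in> orientation_relations L q"
      unfolding orientation_relations_def
      using ordered_simplices_mono[OF assms] by (intro generate.incl) blast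
  qed
  then show ?thesis
    by simp
qed

text \<open>The representative stays the same and only its coset grows; identity and composition
  laws for inclusions follow directly.\<close>

lemma chain_inclusion_r_coset:
  assumes "K \<subseteq> L" "Poly_Mapping.keys c \<subseteq> ordered_simplices K q"
  shows "chain_inclusion L q (orientation_relations K q #>\<^bsub>free_Abelian_group (ordered_simplices K q)\<^esub> c)
    = orientation_relations L q #>\<^bsub>free_Abelian_group (ordered_simplices L q)\<^esub> c"
  unfolding chain_inclusion_def
  using assms orientation_relations_mono[OF assms(1)]
  by (intro coset_map_r_coset orientation_relations_subgroup identity_hom_free_Abelian_group
      ordered_simplices_mono) auto

lemma chain_inclusion_hom:
  assumes "K \<subseteq> L"
  shows "chain_inclusion L q \<in> hom (chain_group K q) (chain_group L q)"
  unfolding chain_group_eq chain_inclusion_def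
  using assms orientation_relations_mono[OF assms(1)] ordered_simplices_mono[OF assms(1), of q]
  by (intro coset_map_hom_subquotient abelian_free_Abelian_group orientation_relations_subgroup
      identity_hom_free_Abelian_group) auto

lemma chain_group_cases:
  assumes "A \<in> carrier (chain_group K q)"
  obtains c where "Poly_Mapping.keys c \<subseteq> ordered_simplices K q"
    "A = orientation_relations K q #>\<^bsub>free_Abelian_group (ordered_simplices K q)\<^esub> c"
  using assms by (auto simp: chain_group_def carrier_FactGroup)

lemma chain_inclusion_id: "A \<in> carrier (chain_group K q) \<Longrightarrow> chain_inclusion K q A = A"
  by (erule chain_group_cases) (simp add: chain_inclusion_r_coset)

lemma chain_inclusion_trans:
  assumes "K \<subseteq> L" "L \<subseteq> M" "A \<in> carrier (chain_group K q)"
  shows "chain_inclusion M q (chain_inclusion L q A) = chain_inclusion M q A"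
  using assms(3)
proof (cases rule: chain_group_cases)
  case (1 c)
  then show ?thesis
    using assms(1,2) ordered_simplices_mono[OF assms(1)]
    by (simp add: chain_inclusion_r_coset[of K] chain_inclusion_r_coset[of L] subset_trans)
qed

text \<open>Since \<open>list_boundary\<close> does not refer to the complex, both sides are the
  \<open>L\<close>-coset of the same chain \<open>frag_extend list_boundary c\<close>.\<close>

lemma boundary_chain_inclusion:
  assumes "simplicial_complex K" "simplicial_complex L" "K \<subseteq> L" "A \<in> carrier (chain_group K q)"
  shows "boundary L q (chain_inclusion L q A) = chain_inclusion L (q - 1) (boundary K q A)"
  using assms(4)
proof (cases rule: chain_group_cases)
  case (1 c)
  moreover from this have "Poly_Mapping.keys c \<subseteq> ordered_simplices L q"
    using ordered_simplices_mono[OF assms(3)] by blast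
  moreover have "Poly_Mapping.keys (frag_extend list_boundary c) \<subseteq> ordered_simplices K (q - 1)"
    using hom_in_carrier[OF frag_extend_list_boundary_hom[OF assms(1)]] 1 by simp
  ultimately show ?thesis
    using assms by (simp add: chain_inclusion_r_coset[of K] boundary_r_coset)
qed


section \<open>Homology\<close>

lemma group_hom_boundary:
  assumes "simplicial_complex K"
  shows "group_hom (chain_group K q) (chain_group K (q - 1)) (boundary K q)"
  using assms by (simp add: group_hom_def group_hom_axioms_def boundary_hom comm_group.axioms(2)
      comm_group_chain_group)

lemma subgroup_boundaries:
  assumes "simplicial_complex K"
  shows "subgroup (boundaries K q) (chain_group K q)"
  using group_hom.img_is_subgroup[OF group_hom_boundary[OF assms, of "q + 1"]]
  by (simp add: boundaries_def)

lemma chain_inclusion_cycles: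
  assumes "simplicial_complex K" "simplicial_complex L" "K \<subseteq> L"
  shows "chain_inclusion L q ` cycles K q \<subseteq> cycles L q"
proof -
  have "chain_inclusion L (q - 1) \<one>\<^bsub>chain_group K (q - 1)\<^esub> = \<one>\<^bsub>chain_group L (q - 1)\<^esub>"
    using chain_inclusion_hom[OF assms(3)] comm_group_chain_group
    by (intro hom_one) (auto simp: comm_group_def)
  then show ?thesis
    using hom_in_carrier[OF chain_inclusion_hom[OF assms(3)]] assms
    by (auto simp: cycles_def kernel_def boundary_chain_inclusion)
qed

lemma chain_inclusion_boundaries:
  assumes "simplicial_complex K" "simplicial_complex L" "K \<subseteq> L"
  shows "chain_inclusion L q ` boundaries K q \<subseteq> boundaries L q"
proof
  fix B assume "B \<in> chain_inclusion L q ` boundaries K q"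
  then obtain A where A: "A \<in> carrier (chain_group K (q + 1))"
    and B: "B = chain_inclusion L q (boundary K (q + 1) A)"
    by (auto simp: boundaries_def)
  then have "B = boundary L (q + 1) (chain_inclusion L (q + 1) A)"
    using boundary_chain_inclusion[OF assms A] by simp
  then show "B \<in> boundaries L q"
    using hom_in_carrier[OF chain_inclusion_hom[OF assms(3)] A] by (simp add: boundaries_def)
qed

lemma homology_inclusion_hom:
  assumes "simplicial_complex K" "simplicial_complex L" "K \<subseteq> L"
  shows "homology_inclusion L q \<in> hom (simplicial_homology K q) (simplicial_homology L q)"
  unfolding homology_inclusion_def simplicial_homology_def
  using assms
  by (intro coset_map_hom_subquotient comm_group_chain_group subgroup_boundaries
      chain_inclusion_hom chain_inclusion_cycles chain_inclusion_boundaries)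
     (auto simp: cycles_def kernel_def)

lemma homology_inclusion_r_coset:
  assumes "simplicial_complex K" "simplicial_complex L" "K \<subseteq> L" "z \<in> carrier (chain_group K q)"
  shows "homology_inclusion L q (boundaries K q #>\<^bsub>chain_group K q\<^esub> z)
    = boundaries L q #>\<^bsub>chain_group L q\<^esub> chain_inclusion L q z"
  unfolding homology_inclusion_def
  using assms comm_group_chain_group
  by (intro coset_map_r_coset subgroup_boundaries chain_inclusion_hom chain_inclusion_boundaries)
     (auto simp: comm_group_def)

lemma simplicial_homology_cases:
  assumes "A \<in> carrier (simplicial_homology K q)"
  obtains z where "z \<in> carrier (chain_group K q)" "A = boundaries K q #>\<^bsub>chain_group K q\<^esub> z"
  using assms by (auto simp: simplicial_homology_def carrier_subquotient cycles_def kernel_def)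

lemma homology_inclusion_id:
  assumes "simplicial_complex K" "A \<in> carrier (simplicial_homology K q)"
  shows "homology_inclusion K q A = A"
  using assms(2)
  by (cases rule: simplicial_homology_cases)
     (simp add: assms(1) homology_inclusion_r_coset chain_inclusion_id)

lemma homology_inclusion_trans:
  assumes "simplicial_complex K" "simplicial_complex L" "simplicial_complex M" "K \<subseteq> L" "L \<subseteq> M"
    and "A \<in> carrier (simplicial_homology K q)"
  shows "homology_inclusion M q (homology_inclusion L q A) = homology_inclusion M q A"
  using assms(6)
proof (cases rule: simplicial_homology_cases)
  case (1 z)
  moreover have "chain_inclusion L q z \<in> carrier (chain_group L q)"
    using hom_in_carrier[OF chain_inclusion_hom[OF assms(4)]] 1 by blast
  ultimately show ?thesis
    using assms by (simp add: homology_inclusion_r_coset[of K] homology_inclusion_r_coset[of L]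
        chain_inclusion_trans[of K L])
qed


section \<open>Cohomology\<close>

text \<open>The group Hom(A, Z) for arbitrary \<open>A\<close>. Cochain groups are instances, and
  coboundaries and restrictions both become precomposition, so their algebra is treated
  once.\<close>

definition dual_group :: "('b, 'm) monoid_scheme \<Rightarrow> ('b \<Rightarrow> int) monoid"
  where "dual_group A = \<lparr>carrier = hom A integer_group \<inter> extensional (carrier A),
    monoid.mult = (\<lambda>f g. \<lambda>c\<in>carrier A. f c + g c), one = (\<lambda>c\<in>carrier A. 0)\<rparr>"

definition dual_map :: "('b, 'm) monoid_scheme \<Rightarrow> ('b \<Rightarrow> 'c) \<Rightarrow> ('c \<Rightarrow> int) \<Rightarrow> 'b \<Rightarrow> int"
  where "dual_map A \<phi> f = (\<lambda>c\<in>carrier A. f (\<phi> c))"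

lemma comm_group_dual_group:
  assumes "group A"
  shows "comm_group (dual_group A)"
proof (rule comm_groupI)
  interpret group A by fact
  show "\<one>\<^bsub>dual_group A\<^esub> \<in> carrier (dual_group A)"
    by (auto simp: dual_group_def hom_def)
  fix f assume f: "f \<in> carrier (dual_group A)"
  \<comment> \<open>Adding zero returns a function restricted to the carrier, which equals
    \<open>f\<close> because \<open>f\<close> is extensional.\<close>
  show "\<one>\<^bsub>dual_group A\<^esub> \<otimes>\<^bsub>dual_group A\<^esub> f = f"
    using f by (auto simp: dual_group_def fun_eq_iff extensional_def)
  show "\<exists>h\<in>carrier (dual_group A). h \<otimes>\<^bsub>dual_group A\<^esub> f = \<one>\<^bsub>dual_group A\<^esub>"
    using f by (intro bexI[of _ "\<lambda>c\<in>carrier A. - f c"]) (auto simp: dual_group_def hom_def)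
  fix g assume g: "g \<in> carrier (dual_group A)"
  show "f \<otimes>\<^bsub>dual_group A\<^esub> g \<in> carrier (dual_group A)"
    using f g by (auto simp: dual_group_def hom_def)
  show "f \<otimes>\<^bsub>dual_group A\<^esub> g = g \<otimes>\<^bsub>dual_group A\<^esub> f"
    by (simp add: dual_group_def add.commute)
  fix h
  show "f \<otimes>\<^bsub>dual_group A\<^esub> g \<otimes>\<^bsub>dual_group A\<^esub> h = f \<otimes>\<^bsub>dual_group A\<^esub> (g \<otimes>\<^bsub>dual_group A\<^esub> h)"
    by (auto simp: dual_group_def fun_eq_iff)
qed

text \<open>Additivity of the restricted composite uses that products in \<open>A\<close> stay in
  its carrier, where the restriction has no effect.\<close>

lemma dual_map_hom:
  assumes "group A" "\<phi> \<in> hom A B"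
  shows "dual_map A \<phi> \<in> hom (dual_group B) (dual_group A)"
proof -
  interpret group A by fact
  show ?thesis
    using assms(2) by (auto simp: dual_group_def dual_map_def hom_def fun_eq_iff Pi_iff)
qed

text \<open>Contravariant functoriality: \<open>\<phi>\<close> lands in the carrier of
  \<open>B\<close>, so the inner restriction disappears.\<close>

lemma dual_map_dual_map:
  assumes "\<phi> \<in> hom A B"
  shows "dual_map A \<phi> (dual_map B \<psi> f) = dual_map A (\<lambda>c. \<psi> (\<phi> c)) f"
  using assms by (auto simp: dual_map_def fun_eq_iff dest: hom_in_carrier)

lemma dual_map_cong:
  "(\<And>c. c \<in> carrier A \<Longrightarrow> \<phi> c = \<psi> c) \<Longrightarrow> dual_map A \<phi> f = dual_map A \<psi> f"
  by (auto simp: dual_map_def fun_eq_iff)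

lemma dual_map_id: "f \<in> carrier (dual_group A) \<Longrightarrow> dual_map A (\<lambda>c. c) f = f"
  by (auto simp: dual_group_def dual_map_def extensional_restrict)

lemma group_chain_group: "group (chain_group K q)"
  by (rule comm_group.axioms(2)[OF comm_group_chain_group])

lemma cochain_group_eq: "cochain_group K q = dual_group (chain_group K q)"
  by (simp add: cochain_group_def dual_group_def)

lemma coboundary_eq: "coboundary K q = dual_map (chain_group K (q + 1)) (boundary K (q + 1))"
  by (auto simp: coboundary_def dual_map_def)

lemma cochain_restriction_eq:
  "cochain_restriction K L q = dual_map (chain_group K q) (chain_inclusion L q)"
  by (auto simp: cochain_restriction_def dual_map_def)

lemma comm_group_cochain_group: "comm_group (cochain_group K q)"
  by (simp add: cochain_group_eq comm_group_dual_group group_chain_group)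

lemma group_cochain_group: "group (cochain_group K q)"
  by (rule comm_group.axioms(2)[OF comm_group_cochain_group])

lemma group_hom_coboundary:
  assumes "simplicial_complex K"
  shows "group_hom (cochain_group K q) (cochain_group K (q + 1)) (coboundary K q)"
  using dual_map_hom[OF group_chain_group boundary_hom[OF assms, of "q + 1"]]
  by (simp add: group_hom_def group_hom_axioms_def group_cochain_group coboundary_eq
      flip: cochain_group_eq)

lemma subgroup_cocycles:
  "simplicial_complex K \<Longrightarrow> subgroup (cocycles K q) (cochain_group K q)"
  unfolding cocycles_def by (intro group_hom.subgroup_kernel group_hom_coboundary)

lemma subgroup_coboundaries:
  assumes "simplicial_complex K"
  shows "subgroup (coboundaries K q) (cochain_group K q)"
  using group_hom.img_is_subgroup[OF group_hom_coboundary[OF assms, of "q - 1"]]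
  by (simp add: coboundaries_def)

lemma cochain_restriction_hom:
  assumes "K \<subseteq> L"
  shows "cochain_restriction K L q \<in> hom (cochain_group L q) (cochain_group K q)"
  unfolding cochain_restriction_eq cochain_group_eq
  by (intro dual_map_hom group_chain_group chain_inclusion_hom assms)

text \<open>Both composites are duals of one map, by the commutation of boundaries with
  inclusions.\<close>

lemma coboundary_cochain_restriction:
  assumes "simplicial_complex K" "simplicial_complex L" "K \<subseteq> L"
  shows "coboundary K q (cochain_restriction K L q f)
    = cochain_restriction K L (q + 1) (coboundary L q f)"
proof -
  \<comment> \<open>Normalises the target degree \<open>q + 1 - 1\<close> to \<open>q\<close>, as
    needed to match the inner dual map.\<close>
  have "boundary K (q + 1) \<in> hom (chain_group K (q + 1)) (chain_group K q)"
    using boundary_hom[OF assms(1), of "q + 1"] by simp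
  moreover have "chain_inclusion L q (boundary K (q + 1) c)
      = boundary L (q + 1) (chain_inclusion L (q + 1) c)" if "c \<in> carrier (chain_group K (q + 1))" for c
    using boundary_chain_inclusion[OF assms that] by simp
  ultimately show ?thesis
    unfolding coboundary_eq cochain_restriction_eq
    by (simp add: dual_map_dual_map dual_map_dual_map[OF chain_inclusion_hom[OF assms(3)]]
        cong: dual_map_cong)
qed

lemma cochain_restriction_cocycles:
  assumes "simplicial_complex K" "simplicial_complex L" "K \<subseteq> L"
  shows "cochain_restriction K L q ` cocycles L q \<subseteq> cocycles K q"
proof -
  have "cochain_restriction K L (q + 1) \<one>\<^bsub>cochain_group L (q + 1)\<^esub> = \<one>\<^bsub>cochain_group K (q + 1)\<^esub>"
    by (rule hom_one[OF cochain_restriction_hom[OF assms(3)] group_cochain_group group_cochain_group])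
  then show ?thesis
    using hom_in_carrier[OF cochain_restriction_hom[OF assms(3)]]
    by (auto simp: cocycles_def kernel_def coboundary_cochain_restriction[OF assms])
qed

lemma cochain_restriction_coboundaries:
  assumes "simplicial_complex K" "simplicial_complex L" "K \<subseteq> L"
  shows "cochain_restriction K L q ` coboundaries L q \<subseteq> coboundaries K q"
proof
  fix g assume "g \<in> cochain_restriction K L q ` coboundaries L q"
  then obtain f where f: "f \<in> carrier (cochain_group L (q - 1))"
    and g: "g = cochain_restriction K L q (coboundary L (q - 1) f)"
    by (auto simp: coboundaries_def)
  then have "g = coboundary K (q - 1) (cochain_restriction K L (q - 1) f)"
    using coboundary_cochain_restriction[OF assms, of "q - 1" f] by simp
  then show "g \<in> coboundaries K q"
    using hom_in_carrier[OF cochain_restriction_hom[OF assms(3)] f] by (simp add: coboundaries_def)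
qed

lemma cohomology_restriction_hom:
  assumes "simplicial_complex K" "simplicial_complex L" "K \<subseteq> L"
  shows "cohomology_restriction K L q \<in> hom (simplicial_cohomology L q) (simplicial_cohomology K q)"
  unfolding cohomology_restriction_def simplicial_cohomology_def
  using assms
  by (intro coset_map_hom_subquotient comm_group_cochain_group subgroup_coboundaries
      cochain_restriction_hom cochain_restriction_cocycles cochain_restriction_coboundaries)
     (auto simp: cocycles_def kernel_def)

lemma cohomology_restriction_r_coset:
  assumes "simplicial_complex K" "simplicial_complex L" "K \<subseteq> L" "f \<in> carrier (cochain_group L q)"
  shows "cohomology_restriction K L q (coboundaries L q #>\<^bsub>cochain_group L q\<^esub> f)
    = coboundaries K q #>\<^bsub>cochain_group K q\<^esub> cochain_restriction K L q f"
  unfolding cohomology_restriction_def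
  using assms
  by (intro coset_map_r_coset group_cochain_group subgroup_coboundaries cochain_restriction_hom
      cochain_restriction_coboundaries)

lemma simplicial_cohomology_cases:
  assumes "A \<in> carrier (simplicial_cohomology K q)"
  obtains f where "f \<in> carrier (cochain_group K q)" "A = coboundaries K q #>\<^bsub>cochain_group K q\<^esub> f"
  using assms by (auto simp: simplicial_cohomology_def carrier_subquotient cocycles_def kernel_def)

lemma cohomology_restriction_id:
  assumes "simplicial_complex K" "A \<in> carrier (simplicial_cohomology K q)"
  shows "cohomology_restriction K K q A = A"
  using assms(2)
proof (cases rule: simplicial_cohomology_cases)
  case (1 f)
  then have "cochain_restriction K K q f = f"
    unfolding cochain_restriction_eq cochain_group_eq
    by (simp add: chain_inclusion_id dual_map_id cong: dual_map_cong)
  then show ?thesis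
    using 1 assms(1) by (simp add: cohomology_restriction_r_coset)
qed

lemma cohomology_restriction_trans:
  assumes "simplicial_complex K" "simplicial_complex L" "simplicial_complex M" "K \<subseteq> L" "L \<subseteq> M"
    and "A \<in> carrier (simplicial_cohomology M q)"
  shows "cohomology_restriction K L q (cohomology_restriction L M q A) = cohomology_restriction K M q A"
  using assms(6)
proof (cases rule: simplicial_cohomology_cases)
  case (1 f)
  have "cochain_restriction L M q f \<in> carrier (cochain_group L q)"
    using hom_in_carrier[OF cochain_restriction_hom[OF assms(5)]] 1 by blast
  moreover have "cochain_restriction K L q (cochain_restriction L M q f) = cochain_restriction K M q f"
    unfolding cochain_restriction_eq
    by (simp add: dual_map_dual_map[OF chain_inclusion_hom[OF assms(4)]]
        chain_inclusion_trans[OF assms(4,5)] cong: dual_map_cong)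
  moreover have "K \<subseteq> M"
    using assms by blast
  ultimately show ?thesis
    using assms 1 by (simp add: cohomology_restriction_r_coset)
qed

text \<open>Serves the direct limit, where a product formed at a common stage must again be an
  element of that stage.\<close>

lemma simplicial_cohomology_mult_closed:
  assumes "simplicial_complex K" "A \<in> carrier (simplicial_cohomology K q)"
    "B \<in> carrier (simplicial_cohomology K q)"
  shows "A \<otimes>\<^bsub>simplicial_cohomology K q\<^esub> B \<in> carrier (simplicial_cohomology K q)"
  using assms unfolding simplicial_cohomology_def
  by (intro subquotient_mult_closed comm_group_cochain_group subgroup_coboundaries subgroup_cocycles)


section \<open>Vietoris-Rips complexes of graphs\<close>

lemma vietoris_rips_complex_mono:
  "U \<subseteq> U' \<Longrightarrow> vietoris_rips_complex X U \<subseteq> vietoris_rips_complex X U'"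
  unfolding vietoris_rips_complex_def by blast

text \<open>This is an equality of sets of simplices, so homology and cohomology can be rewritten
  along it without constructing any further isomorphism.\<close>

lemma vietoris_rips_complex_eq_clique_complex:
  assumes "sym E"
  shows "vietoris_rips_complex V E = clique_complex V E"
proof (intro equalityI subsetI)
  fix s assume "s \<in> vietoris_rips_complex V E"
  then obtain xs where s: "s \<subseteq> V" "xs \<noteq> []" "set xs = s"
    and E: "\<And>i j. i < j \<Longrightarrow> j < length xs \<Longrightarrow> (xs ! i, xs ! j) \<in> E"
    by (auto simp: vietoris_rips_complex_def)
  have "(x, y) \<in> E" if xy: "x \<in> s" "y \<in> s" "x \<noteq> y" for x y
  proof -
    obtain i j where "i < length xs" "x = xs ! i" "j < length xs" "y = xs ! j"
      using xy s(3) by (auto simp: in_set_conv_nth)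
    \<comment> \<open>The given ordering lists \<open>x\<close> and \<open>y\<close> in one order or
      the other; symmetry of \<open>E\<close> covers the case where \<open>y\<close> comes before
      \<open>x\<close>.\<close>
    then show ?thesis
      using E[of i j] E[of j i] xy(3) symD[OF assms] by (cases i j rule: linorder_cases) auto
  qed
  then show "s \<in> clique_complex V E"
    using s by (auto simp: clique_complex_def)
next
  fix s assume s: "s \<in> clique_complex V E"
  then have "finite s"
    by (simp add: clique_complex_def)
  then obtain xs where xs: "set xs = s" "distinct xs"
    using finite_distinct_list by blast
  \<comment> \<open>In a clique any enumeration without repetition will do, since distinct vertices
    are related in both directions.\<close>
  moreover have "(xs ! i, xs ! j) \<in> E" if "i < j" "j < length xs" for i j
  proof -
    have "xs ! i \<noteq> xs ! j" "xs ! i \<in> s" "xs ! j \<in> s"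
      using that xs by (auto simp: nth_eq_iff_index_eq)
    then show ?thesis
      using s by (simp add: clique_complex_def)
  qed
  ultimately show "s \<in> vietoris_rips_complex V E"
    using s by (auto simp: clique_complex_def vietoris_rips_complex_def)
qed

theorem theorem5p5:
  fixes V :: "'a set" and E :: "('a \<times> 'a) set" and q :: int
  assumes "undirected_graph V E"
  shows "VR_homology V (generated_filter (V \<times> V) E) q
           \<cong> simplicial_homology (clique_complex V E) q
       \<and> VR_cohomology V (generated_filter (V \<times> V) E) q
           \<cong> simplicial_cohomology (clique_complex V E) q"
proof -
  let ?F = "generated_filter (V \<times> V) E" and ?K = "vietoris_rips_complex V"
  note sc = simplicial_complex_vietoris_rips_complex[of V]
  have least: "E \<in> ?F" "\<And>U. U \<in> ?F \<Longrightarrow> E \<subseteq> U"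
    using assms by (auto simp: generated_filter_def undirected_graph_def)
  have "VR_homology V ?F q \<cong> simplicial_homology (?K E) q"
    unfolding VR_homology_def
  proof (rule inverse_limit_least_iso[where leq = "(\<subseteq>)", OF least])
    fix U U' :: "'a rel" and A assume "U \<subseteq> U'" "A \<in> carrier (simplicial_homology (?K U) q)"
    then show "homology_inclusion (?K U') q A \<in> carrier (simplicial_homology (?K U') q)"
      using hom_in_carrier[OF homology_inclusion_hom[OF sc sc vietoris_rips_complex_mono]] by blast
  next
    fix U :: "'a rel" and A assume "A \<in> carrier (simplicial_homology (?K U) q)"
    then show "homology_inclusion (?K U) q A = A"
      by (rule homology_inclusion_id[OF sc])
  next
    fix U U' U'' :: "'a rel" and A assume "U \<subseteq> U'" "U' \<subseteq> U''" "A \<in> carrier (simplicial_homology (?K U) q)"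
    then show "homology_inclusion (?K U'') q (homology_inclusion (?K U') q A)
        = homology_inclusion (?K U'') q A"
      by (intro homology_inclusion_trans[OF sc sc sc] vietoris_rips_complex_mono)
  qed
  moreover have "VR_cohomology V ?F q \<cong> simplicial_cohomology (?K E) q"
    unfolding VR_cohomology_def
  \<comment> \<open>For reverse inclusion the facts in \<open>least\<close> say that
    \<open>E\<close> is the greatest index.\<close>
  proof (rule direct_limit_greatest_iso[where leq = "(\<supseteq>)", OF least])
    fix U U' :: "'a rel" assume "U' \<subseteq> U"
    then show "cohomology_restriction (?K U') (?K U) q
        \<in> hom (simplicial_cohomology (?K U) q) (simplicial_cohomology (?K U') q)"
      by (intro cohomology_restriction_hom sc vietoris_rips_complex_mono)
  next
    fix U :: "'a rel" and A assume "A \<in> carrier (simplicial_cohomology (?K U) q)"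
    then show "cohomology_restriction (?K U) (?K U) q A = A"
      by (rule cohomology_restriction_id[OF sc])
  next
    fix U U' U'' :: "'a rel" and A
    assume "U' \<subseteq> U" "U'' \<subseteq> U'" "A \<in> carrier (simplicial_cohomology (?K U) q)"
    then show "cohomology_restriction (?K U'') (?K U') q (cohomology_restriction (?K U') (?K U) q A)
        = cohomology_restriction (?K U'') (?K U) q A"
      by (intro cohomology_restriction_trans[OF sc sc sc] vietoris_rips_complex_mono)
  next
    fix U :: "'a rel" and A B
    assume "A \<in> carrier (simplicial_cohomology (?K U) q)" "B \<in> carrier (simplicial_cohomology (?K U) q)"
    then show "A \<otimes>\<^bsub>simplicial_cohomology (?K U) q\<^esub> B \<in> carrier (simplicial_cohomology (?K U) q)"
      by (rule simplicial_cohomology_mult_closed[OF sc])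
  qed
  ultimately show ?thesis
    using assms by (simp add: vietoris_rips_complex_eq_clique_complex undirected_graph_def)
qed

end
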